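(* Consider the constrained mechanical system $$M(q)\ddot q+C(q,\dot q)\dot q=f_g+f_c+f,\qquad A(q)\dot q=0,$$ with $q\in\mathbb{R}^n$ and generalized constraint force $f_c\in\mathcal N(A)^\perp$. Let $P$ be the orthogonal projection onto $\mathcal N(A)$, $Q=I-P$, let $\mu$ be any positive scalar, and set $$\bar M=PMP+\mu Q,\qquad S=I-M\bar M^{-1}P,\qquad \Lambda=-A^+\dot A,\qquad \Omega=\Lambda-\Lambda^T,\qquad h(q,\dot q)=f_g(q)-C(q,\dot q)\dot q .$$ Then the non-symmetric matrix $S$ is an oblique projection matrix, $S^2=S$, which satisfies $$QS=S\quad\text{and}\quad SQ=Q$$ (so that $\mathcal R(S)=\mathcal N(A)^\perp$ and $S$ maps any vector in $\mathcal N(A)^\perp$ to itself), and the constraint force is given by $$f_c=-S\big(f+h(q,\dot q)-M\Omega\dot q\big).$$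
   Context: $M(q)\in\mathbb{R}^{n\times n}$ is the symmetric positive-definite inertia matrix, $C(q,\dot q)\in\mathbb{R}^{n\times n}$ contains the Coriolis and centrifugal terms, $A(q)\in\mathbb{R}^{m\times n}$ is the constraint matrix (possibly rank-deficient, with rank possibly depending on $q$), $f_g$ is the gravitational generalized force and $f$ the generalized input force, both in $\mathbb{R}^n$. $\mathcal N$ and $\mathcal R$ denote null space and range, $A^+$ is the Moore–Penrose pseudo-inverse, so that $P=I-A^+A$, and dots denote time derivatives along the motion $q(t)$. An oblique projection matrix is an idempotent matrix that is not symmetric.
   Formalization: S need not be non-symmetric (if M = I then S = Q is symmetric), so S is proved to be an oblique projection exactly when MP ≠ PM; S² = S and all the other claims are proved without restriction. *)

theory Defs
  imports "HOL-Analysis.Analysis"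
begin

definition null_space :: "real^'n^'m \<Rightarrow> (real^'n) set" where
  "null_space A = {x. A *v x = 0}"

definition sym_pos_def :: "real^'n^'n \<Rightarrow> bool" where
  "sym_pos_def M \<longleftrightarrow> transpose M = M \<and> (\<forall>x. x \<noteq> 0 \<longrightarrow> x \<bullet> (M *v x) > 0)"

definition oblique_projection :: "real^'n^'n \<Rightarrow> bool" where
  "oblique_projection S \<longleftrightarrow> S ** S = S \<and> transpose S \<noteq> S"

(* The four Penrose equations; over the reals they have exactly one solution X,
   whatever the rank of A. *)
definition is_pseudo_inverse :: "real^'n^'m \<Rightarrow> real^'m^'n \<Rightarrow> bool" where
  "is_pseudo_inverse A X \<longleftrightarrow>
     A ** X ** A = A \<and> X ** A ** X = X \<and>
     transpose (A ** X) = A ** X \<and> transpose (X ** A) = X ** A"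

definition pseudo_inverse :: "real^'n^'m \<Rightarrow> real^'m^'n" where
  "pseudo_inverse A = (THE X. is_pseudo_inverse A X)"

(* Uniquely determined when U is a subspace, the only case in which it is used. *)
definition orthogonal_projection :: "(real^'n) set \<Rightarrow> real^'n^'n" where
  "orthogonal_projection U = (THE P. \<forall>x. P *v x \<in> U \<and> x - P *v x \<in> U\<^sup>\<bottom>)"

definition projP :: "real^'n^'m \<Rightarrow> real^'n^'n" where
  "projP A = orthogonal_projection (null_space A)"

definition projQ :: "real^'n^'m \<Rightarrow> real^'n^'n" where
  "projQ A = mat 1 - projP A"

definition Mbar :: "real \<Rightarrow> real^'n^'n \<Rightarrow> real^'n^'m \<Rightarrow> real^'n^'n" where
  "Mbar \<mu> M A = projP A ** M ** projP A + \<mu> *\<^sub>R projQ A"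

definition matS :: "real \<Rightarrow> real^'n^'n \<Rightarrow> real^'n^'m \<Rightarrow> real^'n^'n" where
  "matS \<mu> M A = mat 1 - M ** matrix_inv (Mbar \<mu> M A) ** projP A"

(* In the next two definitions the second argument A' stands for the time derivative of A. *)
definition matLambda :: "real^'n^'m \<Rightarrow> real^'n^'m \<Rightarrow> real^'n^'n" where
  "matLambda A A' = - (pseudo_inverse A ** A')"

definition matOmega :: "real^'n^'m \<Rightarrow> real^'n^'m \<Rightarrow> real^'n^'n" where
  "matOmega A A' = matLambda A A' - transpose (matLambda A A')"

definition hvec ::
  "(real^'n \<Rightarrow> real^'n) \<Rightarrow> (real^'n \<Rightarrow> real^'n \<Rightarrow> real^'n^'n) \<Rightarrow> real^'n \<Rightarrow> real^'n \<Rightarrow> real^'n" where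
  "hvec fg C x v = fg x - C x v *v v"

end

(* With S = 1 - M Mbar^-1 P, everything rests on the fact that Mbar commutes with P, which gives
   P S = 0 and S M P = 0. Since f_c = S f_c, applying S to the equation of motion leaves only the
   normal part Q q'' of the acceleration, and differentiating A q' = 0 identifies it:
   Q q'' = A^+ A q'' = - A^+ A' q' = Lambda q'. Finally Lambda^T q' = 0 because (A^+)^T vanishes on
   the null space of A. *)

theory Submission
  imports Defs
begin

section \<open>Matrix algebra: distributivity, scalars, transposes\<close>

lemma matrix_mult_add_left:
  fixes A B :: "real^'n^'m" and C :: "real^'p^'n"
  shows "(A + B) ** C = A ** C + B ** C"
  by (simp add: matrix_eq matrix_vector_mult_add_rdistrib flip: matrix_vector_mul_assoc)

lemma matrix_mult_diff_left:
  fixes A B :: "real^'n^'m" and C :: "real^'p^'n"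
  shows "(A - B) ** C = A ** C - B ** C"
  by (simp add: matrix_eq matrix_vector_mult_diff_rdistrib flip: matrix_vector_mul_assoc)

lemma matrix_mult_diff_right:
  fixes A :: "real^'n^'m" and B C :: "real^'p^'n"
  shows "A ** (B - C) = A ** B - A ** C"
  by (simp add: matrix_eq matrix_vector_mult_diff_rdistrib matrix_vector_mult_diff_distrib
      flip: matrix_vector_mul_assoc)

lemma matrix_mult_scaleR_left:
  fixes A :: "real^'n^'m" and B :: "real^'p^'n"
  shows "(c *\<^sub>R A) ** B = c *\<^sub>R (A ** B)"
  by (simp add: matrix_eq flip: matrix_vector_mul_assoc scaleR_matrix_vector_assoc)

lemma matrix_mult_scaleR_right:
  fixes A :: "real^'n^'m" and B :: "real^'p^'n"
  shows "A ** (c *\<^sub>R B) = c *\<^sub>R (A ** B)"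
  by (simp add: matrix_eq matrix_vector_mult_scaleR flip: matrix_vector_mul_assoc scaleR_matrix_vector_assoc)

lemma transpose_diff:
  fixes A B :: "real^'n^'m"
  shows "transpose (A - B) = transpose A - transpose B"
  by (simp add: transpose_def vec_eq_iff)

lemma inner_matrix_vector_mult_transpose:
  fixes A :: "real^'n^'m"
  shows "x \<bullet> (A *v y) = (transpose A *v x) \<bullet> y"
  by (simp add: dot_lmul_matrix)

lemma symmetric_matrixI:
  fixes A :: "real^'n^'n"
  assumes "\<And>x y. x \<bullet> (A *v y) = (A *v x) \<bullet> y"
  shows "transpose A = A"
proof -
  have "(transpose A *v x) \<bullet> y = (A *v x) \<bullet> y" for x y
    using assms inner_matrix_vector_mult_transpose by metis
  then show ?thesis
    unfolding matrix_eq by (metis vector_eq_rdot)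
qed

subsection \<open>Orthogonal projections\<close>

lemma orthogonal_comp_iff: "x \<in> U\<^sup>\<bottom> \<longleftrightarrow> (\<forall>y\<in>U. y \<bullet> x = 0)"
  by (simp add: orthogonal_comp_def orthogonal_def)

text \<open>The difference of two candidates lies both in \<open>U\<close> and in its orthogonal
  complement, hence is orthogonal to itself.\<close>

lemma orthogonal_decomp_unique:
  fixes U :: "'a::euclidean_space set"
  assumes U: "subspace U" and "y \<in> U" "x - y \<in> U\<^sup>\<bottom>" "z \<in> U" "x - z \<in> U\<^sup>\<bottom>"
  shows "y = z"
proof -
  have "y - z \<in> U"
    using assms by (simp add: subspace_diff)
  moreover have "(x - z) - (x - y) \<in> U\<^sup>\<bottom>"
    by (rule subspace_diff[OF subspace_orthogonal_comp assms(5,3)])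
  ultimately have "(y - z) \<bullet> (y - z) = 0"
    by (simp add: orthogonal_comp_iff)
  then show ?thesis by simp
qed

text \<open>Evaluates the \<open>THE\<close> in \<open>orthogonal_projection\<close>: exhibiting one
  matrix with the defining property suffices. It is used for the existence proof and later for
  \<open>mat 1 - pseudo_inverse A ** A\<close>.\<close>

lemma orthogonal_projection_unique:
  assumes "subspace U"
    and "\<And>x. R *v x \<in> U" "\<And>x. x - R *v x \<in> U\<^sup>\<bottom>"
  shows "orthogonal_projection U = R"
  unfolding orthogonal_projection_def
proof (rule the_equality)
  show "\<forall>x. R *v x \<in> U \<and> x - R *v x \<in> U\<^sup>\<bottom>"
    using assms by blast
next
  fix P assume "\<forall>x. P *v x \<in> U \<and> x - P *v x \<in> U\<^sup>\<bottom>"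
  then show "P = R"
    unfolding matrix_eq using assms orthogonal_decomp_unique by blast
qed

text \<open>Pointwise decomposition selects a function \<open>p\<close>. Sums and multiples of
  decompositions are again decompositions, so uniqueness makes \<open>p\<close> linear and hence a
  matrix.\<close>

lemma orthogonal_projection_exists:
  fixes U :: "(real^'n) set"
  assumes U: "subspace U"
  obtains R :: "real^'n^'n" where "\<And>x. R *v x \<in> U" "\<And>x. x - R *v x \<in> U\<^sup>\<bottom>"
proof -
  have "\<exists>y. y \<in> U \<and> x - y \<in> U\<^sup>\<bottom>" for x
  proof -
    obtain y z where "y \<in> U" "\<And>w. w \<in> U \<Longrightarrow> orthogonal z w" "x = y + z"
      using orthogonal_subspace_decomp_exists[of U x] U span_eq_iff by metis
    then show ?thesis
      by (intro exI[of _ y]) (auto simp: orthogonal_comp_def orthogonal_commute)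
  qed
  then obtain p where p: "\<And>x. p x \<in> U" "\<And>x. x - p x \<in> U\<^sup>\<bottom>"
    by metis
  have "linear p"
  proof (rule linearI)
    fix x y
    have "(x - p x) + (y - p y) \<in> U\<^sup>\<bottom>"
      by (intro subspace_add subspace_orthogonal_comp p)
    then have "x + y - (p x + p y) \<in> U\<^sup>\<bottom>"
      by (simp add: algebra_simps)
    then show "p (x + y) = p x + p y"
      by (intro orthogonal_decomp_unique[OF U, of _ "x + y"] p subspace_add[OF U])
  next
    fix c x
    have "c *\<^sub>R (x - p x) \<in> U\<^sup>\<bottom>"
      by (intro subspace_mul subspace_orthogonal_comp p)
    then have "c *\<^sub>R x - c *\<^sub>R p x \<in> U\<^sup>\<bottom>"
      by (simp add: algebra_simps)
    then show "p (c *\<^sub>R x) = c *\<^sub>R p x"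
      by (intro orthogonal_decomp_unique[OF U, of _ "c *\<^sub>R x"] p subspace_mul[OF U])
  qed
  then have "matrix p *v x = p x" for x
    by (simp add: matrix_works)
  with p show ?thesis
    by (intro that[of "matrix p"]) simp_all
qed

lemma orthogonal_projection_in:
  assumes "subspace U"
  shows "orthogonal_projection U *v x \<in> U" "x - orthogonal_projection U *v x \<in> U\<^sup>\<bottom>"
  using assms orthogonal_projection_exists[OF assms] orthogonal_projection_unique[OF assms]
  by metis+

lemma orthogonal_projection_fixes:
  assumes "subspace U" "x \<in> U"
  shows "orthogonal_projection U *v x = x"
  using orthogonal_decomp_unique[OF assms(1)] orthogonal_projection_in[OF assms(1)] assms(2)
    subspace_0[OF subspace_orthogonal_comp] by (metis diff_self)

lemma orthogonal_projection_eq_0_iff: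
  assumes "subspace U"
  shows "orthogonal_projection U *v x = 0 \<longleftrightarrow> x \<in> U\<^sup>\<bottom>"
  using orthogonal_decomp_unique[OF assms] orthogonal_projection_in[OF assms] subspace_0[OF assms]
  by (metis diff_zero)

lemma orthogonal_projection_idem:
  assumes "subspace U"
  shows "orthogonal_projection U ** orthogonal_projection U = orthogonal_projection U"
  unfolding matrix_eq
  by (simp add: orthogonal_projection_fixes orthogonal_projection_in assms flip: matrix_vector_mul_assoc)

text \<open>The residuals of \<open>x\<close> and \<open>y\<close> are orthogonal to
  \<open>U\<close>, so both sides of the symmetry condition equal the inner product of the two
  projected vectors.\<close>

lemma transpose_orthogonal_projection:
  assumes U: "subspace U"
  shows "transpose (orthogonal_projection U) = orthogonal_projection U"
proof (rule symmetric_matrixI)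
  fix x y
  let ?P = "orthogonal_projection U"
  have "(?P *v y) \<bullet> (x - ?P *v x) = 0" "(?P *v x) \<bullet> (y - ?P *v y) = 0"
    using orthogonal_projection_in[OF U] orthogonal_comp_iff by blast+
  then show "x \<bullet> (?P *v y) = (?P *v x) \<bullet> y"
    by (simp add: inner_diff_right inner_commute)
qed

section \<open>The complementary projections P and Q attached to the null space\<close>

lemma subspace_null_space: "subspace (null_space A)"
  by (auto simp: subspace_def null_space_def matrix_vector_right_distrib matrix_vector_mult_scaleR)

lemma projP_idem: "projP A ** projP A = projP A"
  by (simp add: projP_def orthogonal_projection_idem subspace_null_space)

lemma transpose_projP: "transpose (projP A) = projP A"
  by (simp add: projP_def transpose_orthogonal_projection subspace_null_space)

lemma projP_eq_0_iff: "projP A *v x = 0 \<longleftrightarrow> x \<in> (null_space A)\<^sup>\<bottom>"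
  by (simp add: projP_def orthogonal_projection_eq_0_iff subspace_null_space)

lemma transpose_projQ: "transpose (projQ A) = projQ A"
  by (simp add: projQ_def transpose_diff transpose_projP)

lemma projP_projQ: "projP A ** projQ A = 0" "projQ A ** projP A = 0"
  by (simp_all add: projQ_def matrix_mult_diff_left matrix_mult_diff_right projP_idem)

lemma projQ_idem: "projQ A ** projQ A = projQ A"
proof -
  have "projQ A ** projQ A = mat 1 ** projQ A - projP A ** projQ A"
    by (simp only: projQ_def[of A] matrix_mult_diff_left)
  then show ?thesis by (simp add: projP_projQ)
qed

subsection \<open>The pseudo-inverse\<close>

text \<open>Inserting \<open>A ** Y ** A\<close> for \<open>A\<close> and transposing swaps the
  symmetric factors \<open>A ** Y\<close> and \<open>A ** X\<close>, which yields
  \<open>A ** X = A ** Y\<close>; likewise \<open>X ** A = Y ** A\<close>. Then X = XAX = XAY = YAY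
  = Y.\<close>

lemma is_pseudo_inverse_unique:
  assumes X: "is_pseudo_inverse A X" and Y: "is_pseudo_inverse A Y"
  shows "X = Y"
proof -
  note X = X[unfolded is_pseudo_inverse_def] and Y = Y[unfolded is_pseudo_inverse_def]
  have "A ** X = transpose ((A ** Y ** A) ** X)"
    using X Y by simp
  also have "\<dots> = transpose ((A ** Y) ** (A ** X))"
    by (simp add: matrix_mul_assoc)
  also have "\<dots> = (A ** X) ** (A ** Y)"
    using X Y by (simp only: matrix_transpose_mul[of "A ** Y"])
  also have "\<dots> = (A ** X ** A) ** Y"
    by (simp only: matrix_mul_assoc)
  finally have AX: "A ** X = A ** Y"
    using X by simp
  have "X ** A = transpose (X ** (A ** Y ** A))"
    using X Y by simp
  also have "\<dots> = transpose ((X ** A) ** (Y ** A))"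
    by (simp add: matrix_mul_assoc)
  also have "\<dots> = (Y ** A) ** (X ** A)"
    using X Y by (simp only: matrix_transpose_mul[of "X ** A"])
  also have "\<dots> = Y ** (A ** X ** A)"
    by (simp only: matrix_mul_assoc)
  finally have XA: "X ** A = Y ** A"
    using X by simp
  have "X = X ** (A ** X)"
    using X by (simp add: matrix_mul_assoc)
  also have "\<dots> = X ** A ** Y"
    by (simp add: AX matrix_mul_assoc)
  also have "\<dots> = Y"
    using Y by (simp add: XA)
  finally show ?thesis .
qed

lemma matrix_projP: "A ** projP A = 0"
proof -
  have "A *v (projP A *v x) = 0" for x
    using orthogonal_projection_in(1)[OF subspace_null_space, of A x]
    by (simp add: projP_def null_space_def)
  then show ?thesis
    by (simp add: matrix_eq flip: matrix_vector_mul_assoc)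
qed

lemma matrix_projQ: "A ** projQ A = A"
  by (simp add: projQ_def matrix_mult_diff_right matrix_projP)

text \<open>On the orthogonal complement of its null space \<open>A\<close> is injective, so it has
  a linear left inverse \<open>G\<close> there. The witness is \<open>G ** R\<close>: project onto
  the range of \<open>A\<close>, then invert. The two products become \<open>R\<close> and
  \<open>projQ A\<close>, both symmetric projections.\<close>

lemma pseudo_inverse_exists:
  fixes A :: "real^'n^'m"
  shows "\<exists>X. is_pseudo_inverse A X"
proof -
  let ?V = "(null_space A)\<^sup>\<bottom>"
  define R where "R = orthogonal_projection (range ((*v) A))"
  have range: "subspace (range ((*v) A))"
    by (simp add: linear_subspace_image)
  have "inj_on ((*v) A) ?V"
  proof (rule inj_onI)
    fix u v assume uv: "u \<in> ?V" "v \<in> ?V" "A *v u = A *v v"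
    then have "u - v \<in> ?V" "u - v \<in> null_space A"
      by (auto simp: subspace_diff subspace_orthogonal_comp null_space_def
          matrix_vector_mult_diff_distrib)
    then have "(u - v) \<bullet> (u - v) = 0"
      unfolding orthogonal_comp_iff by blast
    then show "u = v" by simp
  qed
  then obtain g where g: "linear g" "\<And>v. v \<in> ?V \<Longrightarrow> g (A *v v) = v" "range g \<subseteq> ?V"
    using linear_exists_left_inverse_on[OF matrix_vector_mul_linear subspace_orthogonal_comp]
    by metis
  define G where "G = matrix g"
  have G: "G *v x = g x" for x
    using g(1) by (simp add: G_def matrix_works)
  have Q_in: "projQ A *v x \<in> ?V" for x
    using projP_projQ(1)[of A]
    by (simp add: matrix_vector_mul_assoc flip: projP_eq_0_iff)
  have AQ: "A *v x = A *v (projQ A *v x)" for x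
    by (simp add: matrix_vector_mul_assoc matrix_projQ)
  have GA: "G ** A = projQ A"
    unfolding matrix_eq using AQ G g(2) Q_in by (metis matrix_vector_mul_assoc)
  have RA: "R ** A = A"
    unfolding matrix_eq R_def
    by (simp add: orthogonal_projection_fixes range flip: matrix_vector_mul_assoc)
  have AGR: "A ** G ** R = R"
    unfolding matrix_eq
  proof
    fix y
    obtain x where x: "R *v y = A *v x"
      using orthogonal_projection_in(1)[OF range] unfolding R_def by blast
    \<comment> \<open>\<open>G\<close> recovers only the Q-part of \<open>x\<close>, but the missing
      part lies in the null space of \<open>A\<close>.\<close>
    have "A *v (G *v (A *v x)) = A *v x"
      by (metis GA AQ matrix_vector_mul_assoc)
    then show "A ** G ** R *v y = R *v y"
      by (simp add: x flip: matrix_vector_mul_assoc)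
  qed
  have "transpose R = R" "R ** R = R"
    by (simp_all add: R_def transpose_orthogonal_projection orthogonal_projection_idem range)
  \<comment> \<open>The left inverse was chosen with all its values in the complement of the null
    space; this gives the Penrose equation XAX = X.\<close>
  moreover have "projQ A ** G = G"
  proof -
    have "projP A *v (G *v x) = 0" for x
      using g(3) by (auto simp: G projP_eq_0_iff)
    then show ?thesis
      by (simp add: projQ_def matrix_eq matrix_vector_mult_diff_rdistrib flip: matrix_vector_mul_assoc)
  qed
  moreover have "G ** R ** A = projQ A"
    by (simp add: RA GA flip: matrix_mul_assoc)
  ultimately have "is_pseudo_inverse A (G ** R)"
    by (simp add: is_pseudo_inverse_def AGR RA transpose_projQ matrix_mul_assoc)
  then show ?thesis ..
qed

lemma is_pseudo_inverse_pseudo_inverse: "is_pseudo_inverse A (pseudo_inverse A)"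
  unfolding pseudo_inverse_def
  using pseudo_inverse_exists is_pseudo_inverse_unique by (metis theI)

text \<open>\<open>mat 1 - pseudo_inverse A ** A\<close> has the property that characterises
  \<open>projP A\<close>: AXA = A puts its values in the null space, and the symmetry of XA makes
  the residual orthogonal to it.\<close>

lemma pseudo_inverse_mult_eq_projQ: "pseudo_inverse A ** A = projQ A"
proof -
  let ?X = "pseudo_inverse A"
  have X: "A ** ?X ** A = A" "transpose (?X ** A) = ?X ** A"
    using is_pseudo_inverse_pseudo_inverse[of A] by (simp_all add: is_pseudo_inverse_def)
  have "projP A = mat 1 - ?X ** A"
    unfolding projP_def
  proof (rule orthogonal_projection_unique[OF subspace_null_space])
    fix x
    have "A ** (mat 1 - ?X ** A) = 0"
      using X(1) by (simp add: matrix_mult_diff_right matrix_mul_assoc)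
    then show "(mat 1 - ?X ** A) *v x \<in> null_space A"
      by (simp add: null_space_def matrix_vector_mul_assoc)
    have "y \<bullet> (?X ** A *v x) = 0" if "A *v y = 0" for y
    proof -
      have "y \<bullet> (?X ** A *v x) = (?X ** A *v y) \<bullet> x"
        using inner_matrix_vector_mult_transpose X(2) by metis
      also have "?X ** A *v y = 0"
        by (simp add: that flip: matrix_vector_mul_assoc)
      finally show ?thesis by simp
    qed
    then show "x - (mat 1 - ?X ** A) *v x \<in> (null_space A)\<^sup>\<bottom>"
      by (simp add: matrix_vector_mult_diff_rdistrib orthogonal_comp_iff null_space_def)
  qed
  then show ?thesis
    by (simp add: projQ_def)
qed

text \<open>Transposing X = (XA)X with XA symmetric gives X^T = X^T X A, a product whose rightmost
  factor is \<open>A\<close>.\<close>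

lemma transpose_pseudo_inverse_null_space:
  assumes "A *v v = 0"
  shows "transpose (pseudo_inverse A) *v v = 0"
proof -
  let ?X = "pseudo_inverse A"
  have X: "?X ** A ** ?X = ?X" "transpose (?X ** A) = ?X ** A"
    using is_pseudo_inverse_pseudo_inverse[of A] by (simp_all add: is_pseudo_inverse_def)
  have "transpose ?X = transpose ?X ** (?X ** A)"
    using X by (metis matrix_transpose_mul)
  then have "transpose ?X *v v = transpose ?X *v (?X *v (A *v v))"
    by (metis matrix_vector_mul_assoc)
  then show ?thesis
    by (simp only: assms matrix_vector_mult_0_right)
qed

subsection \<open>The matrix S\<close>

text \<open>The quadratic form of \<open>Mbar\<close> at \<open>x\<close> is that of
  \<open>M\<close> at \<open>P x\<close> plus \<mu> times the squared norm of \<open>Q x\<close>.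
  Both terms are nonnegative, so a kernel vector has \<open>P x = 0\<close> and
  \<open>Q x = 0\<close>, whatever the rank of \<open>A\<close>.\<close>

lemma Mbar_invertible:
  fixes A :: "real^'n^'m"
  assumes M: "sym_pos_def M" and mu: "\<mu> > 0"
  shows "invertible (Mbar \<mu> M A)"
proof -
  let ?P = "projP A" and ?Q = "projQ A"
  have "x = 0" if x: "Mbar \<mu> M A *v x = 0" for x
  proof -
    have Q: "x \<bullet> (?Q *v x) = (?Q *v x) \<bullet> (?Q *v x)"
      by (metis inner_matrix_vector_mult_transpose matrix_vector_mul_assoc projQ_idem transpose_projQ)
    have "0 = x \<bullet> (?P *v (M *v (?P *v x))) + \<mu> * (x \<bullet> (?Q *v x))"
      using arg_cong[OF x, of "(\<bullet>) x"]
      by (simp add: Mbar_def matrix_vector_mult_add_rdistrib inner_add_right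
          flip: matrix_vector_mul_assoc scaleR_matrix_vector_assoc)
    also have "x \<bullet> (?P *v (M *v (?P *v x))) = (?P *v x) \<bullet> (M *v (?P *v x))"
      by (metis inner_matrix_vector_mult_transpose transpose_projP)
    finally have sum: "(?P *v x) \<bullet> (M *v (?P *v x)) + \<mu> * ((?Q *v x) \<bullet> (?Q *v x)) = 0"
      by (simp add: Q)
    have Qnn: "0 \<le> \<mu> * ((?Q *v x) \<bullet> (?Q *v x))"
      using mu by simp
    have Px: "?P *v x = 0"
      using M sum Qnn unfolding sym_pos_def_def by (metis add_pos_nonneg less_irrefl)
    then have "?Q *v x = 0"
      using sum mu by simp
    then show "x = 0"
      using Px by (simp add: projQ_def matrix_vector_mult_diff_rdistrib)
  qed
  then show ?thesis
    by (auto simp: invertible_left_inverse matrix_left_invertible_ker)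
qed

context
  fixes A :: "real^'n^'m" and M :: "real^'n^'n" and \<mu> :: real
  assumes M: "sym_pos_def M" and mu: "\<mu> > 0"
begin

text \<open>Multiplying by P on either side kills the term with Q and leaves PMP unchanged; in
  particular \<open>Mbar\<close> commutes with P.\<close>

lemma Mbar_projP: "Mbar \<mu> M A ** projP A = projP A ** M ** projP A"
  "projP A ** Mbar \<mu> M A = projP A ** M ** projP A"
proof -
  have "projP A ** M ** projP A ** projP A = projP A ** M ** projP A"
    by (simp add: projP_idem flip: matrix_mul_assoc)
  then show "Mbar \<mu> M A ** projP A = projP A ** M ** projP A"
    by (simp add: Mbar_def matrix_mult_add_left matrix_mult_scaleR_left projP_projQ)
  show "projP A ** Mbar \<mu> M A = projP A ** M ** projP A"
    by (simp add: Mbar_def matrix_add_ldistrib matrix_mult_scaleR_right projP_projQ projP_idem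
        matrix_mul_assoc)
qed

text \<open>\<open>matrix_inv\<close> is a choice of two-sided inverse, so its equations must be
  drawn from invertibility.\<close>

lemma Mbar_inverse:
  "matrix_inv (Mbar \<mu> M A) ** Mbar \<mu> M A = mat 1"
  "Mbar \<mu> M A ** matrix_inv (Mbar \<mu> M A) = mat 1"
proof -
  have "\<exists>B. Mbar \<mu> M A ** B = mat 1 \<and> B ** Mbar \<mu> M A = mat 1"
    using Mbar_invertible[OF M mu] by (simp add: invertible_def)
  then have "Mbar \<mu> M A ** matrix_inv (Mbar \<mu> M A) = mat 1
      \<and> matrix_inv (Mbar \<mu> M A) ** Mbar \<mu> M A = mat 1"
    unfolding matrix_inv_def by (rule someI_ex)
  then show "matrix_inv (Mbar \<mu> M A) ** Mbar \<mu> M A = mat 1"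
    "Mbar \<mu> M A ** matrix_inv (Mbar \<mu> M A) = mat 1" by auto
qed

lemma Mbar_inverse_commute:
  "projP A ** matrix_inv (Mbar \<mu> M A) = matrix_inv (Mbar \<mu> M A) ** projP A"
proof -
  let ?B = "matrix_inv (Mbar \<mu> M A)"
  have "projP A ** ?B = ?B ** (Mbar \<mu> M A ** projP A) ** ?B"
    by (simp add: matrix_mul_assoc Mbar_inverse)
  also have "\<dots> = ?B ** (projP A ** Mbar \<mu> M A) ** ?B"
    by (simp only: Mbar_projP)
  also have "\<dots> = ?B ** projP A ** (Mbar \<mu> M A ** ?B)"
    by (simp add: matrix_mul_assoc)
  finally show ?thesis
    by (simp add: Mbar_inverse)
qed

text \<open>Since P is idempotent and commutes with the inverse of \<open>Mbar\<close>, a second P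
  can be moved next to \<open>M\<close>. The factor PMP then equals P times \<open>Mbar\<close>,
  which cancels the inverse and leaves P.\<close>

lemma projP_matS: "projP A ** matS \<mu> M A = 0"
proof -
  let ?B = "matrix_inv (Mbar \<mu> M A)"
  have "projP A ** (M ** ?B ** projP A) = projP A ** M ** (?B ** (projP A ** projP A))"
    by (simp add: matrix_mul_assoc projP_idem)
  also have "\<dots> = projP A ** M ** (projP A ** ?B ** projP A)"
    by (simp add: Mbar_inverse_commute matrix_mul_assoc)
  also have "\<dots> = (projP A ** Mbar \<mu> M A) ** ?B ** projP A"
    by (simp only: Mbar_projP matrix_mul_assoc)
  also have "\<dots> = projP A ** (Mbar \<mu> M A ** ?B) ** projP A"
    by (simp add: matrix_mul_assoc)
  finally show ?thesis
    by (simp add: matS_def matrix_mult_diff_right Mbar_inverse projP_idem)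
qed

lemma projQ_matS: "projQ A ** matS \<mu> M A = matS \<mu> M A"
  by (simp add: projQ_def matrix_mult_diff_left projP_matS)

lemma matS_projQ: "matS \<mu> M A ** projQ A = projQ A"
  by (simp add: matS_def matrix_mult_diff_left projP_projQ flip: matrix_mul_assoc)

text \<open>SS = S(QS) = (SQ)S = QS = S.\<close>

lemma matS_idem: "matS \<mu> M A ** matS \<mu> M A = matS \<mu> M A"
  by (metis matS_projQ matrix_mul_assoc projQ_matS)

text \<open>PMP is \<open>Mbar\<close> times P, which cancels the inverse. Mechanically, S
  annihilates the inertial force of any acceleration tangent to the constraint.\<close>

lemma matS_M_projP: "matS \<mu> M A ** M ** projP A = 0"
proof -
  let ?B = "matrix_inv (Mbar \<mu> M A)"
  have "M ** ?B ** projP A ** M ** projP A = M ** ?B ** (projP A ** M ** projP A)"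
    by (simp add: matrix_mul_assoc)
  also have "\<dots> = M ** (?B ** Mbar \<mu> M A) ** projP A"
    by (simp only: matrix_mul_assoc flip: Mbar_projP(1))
  finally show ?thesis
    by (simp add: matS_def matrix_mult_diff_left Mbar_inverse)
qed

text \<open>Decides when S is really oblique. If S is symmetric, then S = (QS)^T = SQ = Q, so SMP =
  0 reads MP = PMP; the right side is symmetric, hence MP = PM. Conversely, commutation collapses S
  to the orthogonal projection Q, as happens for \<open>M = mat 1\<close>.\<close>

lemma matS_symmetric_iff:
  "transpose (matS \<mu> M A) = matS \<mu> M A \<longleftrightarrow> M ** projP A = projP A ** M"
proof
  assume sym: "transpose (matS \<mu> M A) = matS \<mu> M A"
  have "matS \<mu> M A = transpose (projQ A ** matS \<mu> M A)"
    by (simp add: projQ_matS sym)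
  also have "\<dots> = projQ A"
    by (simp only: matrix_transpose_mul sym transpose_projQ matS_projQ)
  finally have "(mat 1 - projP A) ** M ** projP A = 0"
    using matS_M_projP by (simp add: projQ_def)
  then have eq: "M ** projP A = projP A ** M ** projP A"
    by (simp add: matrix_mult_diff_left)
  have "projP A ** M = transpose (M ** projP A)"
    using M by (simp add: matrix_transpose_mul transpose_projP sym_pos_def_def)
  also have "\<dots> = projP A ** M ** projP A"
    using M by (subst eq) (simp add: matrix_transpose_mul transpose_projP sym_pos_def_def matrix_mul_assoc)
  finally show "M ** projP A = projP A ** M"
    using eq by simp
next
  assume comm: "M ** projP A = projP A ** M"
  let ?B = "matrix_inv (Mbar \<mu> M A)"
  have PMP: "projP A ** M ** projP A = M ** projP A"
    by (simp add: projP_idem flip: comm matrix_mul_assoc)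
  \<comment> \<open>Under commutation MP equals P times \<open>Mbar\<close>, so the inverse
    cancels.\<close>
  have "M ** ?B ** projP A = (M ** projP A) ** ?B"
    by (simp add: Mbar_inverse_commute flip: matrix_mul_assoc)
  also have "\<dots> = projP A ** (Mbar \<mu> M A ** ?B)"
    by (simp add: matrix_mul_assoc Mbar_projP PMP)
  also have "\<dots> = projP A"
    by (simp add: Mbar_inverse)
  finally have "matS \<mu> M A = projQ A"
    by (simp add: matS_def projQ_def)
  then show "transpose (matS \<mu> M A) = matS \<mu> M A"
    by (simp add: transpose_projQ)
qed

lemma matS_fixes:
  assumes "v \<in> (null_space A)\<^sup>\<bottom>"
  shows "matS \<mu> M A *v v = v"
proof -
  have "projP A *v v = 0"
    using assms by (simp add: projP_eq_0_iff)
  then show ?thesis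
    by (simp add: matS_def matrix_vector_mult_diff_rdistrib flip: matrix_vector_mul_assoc)
qed

lemma range_matS: "range ((*v) (matS \<mu> M A)) = (null_space A)\<^sup>\<bottom>"
proof
  show "range ((*v) (matS \<mu> M A)) \<subseteq> (null_space A)\<^sup>\<bottom>"
    by (auto simp: matrix_vector_mul_assoc projP_matS simp flip: projP_eq_0_iff)
  show "(null_space A)\<^sup>\<bottom> \<subseteq> range ((*v) (matS \<mu> M A))"
    using matS_fixes by (metis rangeI subsetI)
qed

end

subsection \<open>Differentiating the constraint\<close>

lemma bounded_bilinear_matrix_vector_mult:
  "bounded_bilinear ((*v) :: real^'n^'m \<Rightarrow> real^'n \<Rightarrow> real^'m)"
  unfolding bilinear_conv_bounded_bilinear[symmetric] bilinear_def
  by (auto intro!: linearI simp: matrix_vector_mult_add_rdistrib matrix_vector_right_distrib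
      matrix_vector_mult_scaleR scaleR_matrix_vector_assoc)

text \<open>A connected set with more than one point has no isolated points. This makes derivatives
  within \<open>T\<close> unique, also one-sided ones at an endpoint.\<close>

lemma interval_at_within_neq_bot:
  fixes T :: "real set"
  assumes "is_interval T" "interior T \<noteq> {}" "t \<in> T"
  shows "at t within T \<noteq> bot"
proof -
  have "T \<noteq> {x}" for x
    using assms(2) by auto
  then have "t islimpt T"
    using assms is_interval_connected connected_imp_perfect by blast
  then show ?thesis
    by (simp add: trivial_limit_within)
qed

text \<open>The product rule and the constant value 0 on \<open>T\<close> give two derivatives of
  the same function, which must agree.\<close>

lemma constraint_derivative:
  fixes B :: "real \<Rightarrow> real^'n^'m" and v :: "real \<Rightarrow> real^'n"
  assumes "at t within T \<noteq> bot" "t \<in> T"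
    and "(B has_vector_derivative B') (at t within T)"
    and "(v has_vector_derivative v') (at t within T)"
    and zero: "\<And>s. s \<in> T \<Longrightarrow> B s *v v s = 0"
  shows "B t *v v' + B' *v v t = 0"
proof (rule vector_derivative_unique_within)
  show "((\<lambda>s. B s *v v s) has_vector_derivative B t *v v' + B' *v v t) (at t within T)"
    by (intro bounded_bilinear.has_vector_derivative[OF bounded_bilinear_matrix_vector_mult] assms)
  show "((\<lambda>s. B s *v v s) has_vector_derivative 0) (at t within T)"
    by (rule has_vector_derivative_transform[OF \<open>t \<in> T\<close> _ has_vector_derivative_const]) (rule zero)
qed fact

lemma matOmega_eq_normal_acceleration:
  assumes "A *v v = 0" and deriv: "A *v v' + A' *v v = 0"
  shows "matOmega A A' *v v = projQ A *v v'"
proof -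
  have "transpose (matLambda A A') *v v = - (transpose A' *v (transpose (pseudo_inverse A) *v v))"
  proof -
    \<comment> \<open>The sign is written as a scalar so that \<open>transpose_scalar\<close>
      applies.\<close>
    have "matLambda A A' = (-1) *\<^sub>R (pseudo_inverse A ** A')"
      by (simp add: matLambda_def)
    then show ?thesis
      by (simp only: transpose_scalar matrix_transpose_mul
          scaleR_matrix_vector_assoc[symmetric] matrix_vector_mul_assoc) simp
  qed
  then have "transpose (matLambda A A') *v v = 0"
    by (simp only: transpose_pseudo_inverse_null_space[OF assms(1)] matrix_vector_mult_0_right) simp
  then have "matOmega A A' *v v = matLambda A A' *v v"
    by (simp only: matOmega_def matrix_vector_mult_diff_rdistrib) simp
  also have "\<dots> = pseudo_inverse A *v (- (A' *v v))"
    using matrix_vector_mult_diff_rdistrib[of 0 "pseudo_inverse A ** A'" v]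
      matrix_vector_mult_diff_distrib[of "pseudo_inverse A" 0 "A' *v v"]
    by (simp add: matLambda_def matrix_vector_mul_assoc)
  also have "- (A' *v v) = A *v v'"
    using deriv by (intro minus_unique) (simp add: add.commute)
  finally show ?thesis
    by (simp add: matrix_vector_mul_assoc pseudo_inverse_mult_eq_projQ)
qed

text \<open>The matrix identities are stated at every configuration, the force formula at every time
  in \<open>T\<close>. Obliqueness appears as an equivalence, because S is symmetric exactly when
  \<open>M\<close> and P commute. \<open>A'\<close> is the derivative of \<open>A\<close> along the
  motion.\<close>

theorem mainTheorem5:
  fixes M :: "real^'n \<Rightarrow> real^'n^'n"
    and C :: "real^'n \<Rightarrow> real^'n \<Rightarrow> real^'n^'n"
    and A :: "real^'n \<Rightarrow> real^'n^'m"
    and fg :: "real^'n \<Rightarrow> real^'n"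
    and \<mu> :: real
    and T :: "real set"
    and q q' q'' f fc :: "real \<Rightarrow> real^'n"
    and A' :: "real \<Rightarrow> real^'n^'m"
  assumes inertia: "\<And>x. sym_pos_def (M x)"
    and mu_pos: "\<mu> > 0"
    and time: "is_interval T" "interior T \<noteq> {}"
    and velocity: "\<And>t. t \<in> T \<Longrightarrow> (q has_vector_derivative q' t) (at t within T)"
    and acceleration: "\<And>t. t \<in> T \<Longrightarrow> (q' has_vector_derivative q'' t) (at t within T)"
    and A_deriv: "\<And>t. t \<in> T \<Longrightarrow> ((\<lambda>s. A (q s)) has_vector_derivative A' t) (at t within T)"
    and dynamics: "\<And>t. t \<in> T \<Longrightarrow>
          M (q t) *v q'' t + C (q t) (q' t) *v q' t = fg (q t) + fc t + f t"
    and constraint: "\<And>t. t \<in> T \<Longrightarrow> A (q t) *v q' t = 0"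
    and constraint_force: "\<And>t. t \<in> T \<Longrightarrow> fc t \<in> (null_space (A (q t)))\<^sup>\<bottom>"
  shows "(\<forall>x. let P = projP (A x); Q = projQ (A x); S = matS \<mu> (M x) (A x) in
            invertible (Mbar \<mu> (M x) (A x)) \<and>
            S ** S = S \<and>
            (oblique_projection S \<longleftrightarrow> M x ** P \<noteq> P ** M x) \<and>
            Q ** S = S \<and> S ** Q = Q \<and>
            range ((*v) S) = (null_space (A x))\<^sup>\<bottom> \<and>
            (\<forall>v \<in> (null_space (A x))\<^sup>\<bottom>. S *v v = v)) \<and>
         (\<forall>t\<in>T. fc t = - (matS \<mu> (M (q t)) (A (q t)) *v
            (f t + hvec fg C (q t) (q' t)
              - M (q t) *v (matOmega (A (q t)) (A' t) *v q' t))))"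
proof (intro conjI ballI)
  show "\<forall>x. let P = projP (A x); Q = projQ (A x); S = matS \<mu> (M x) (A x) in
            invertible (Mbar \<mu> (M x) (A x)) \<and>
            S ** S = S \<and>
            (oblique_projection S \<longleftrightarrow> M x ** P \<noteq> P ** M x) \<and>
            Q ** S = S \<and> S ** Q = Q \<and>
            range ((*v) S) = (null_space (A x))\<^sup>\<bottom> \<and>
            (\<forall>v \<in> (null_space (A x))\<^sup>\<bottom>. S *v v = v)"
    unfolding Let_def oblique_projection_def
    by (simp add: Mbar_invertible matS_idem matS_symmetric_iff projQ_matS matS_projQ range_matS
        matS_fixes inertia mu_pos)
next
  fix t assume t: "t \<in> T"
  let ?A = "A (q t)" and ?M = "M (q t)"
  let ?S = "matS \<mu> ?M ?A" and ?\<Omega> = "matOmega ?A (A' t)" and ?h = "hvec fg C (q t) (q' t)"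
  note M = inertia[of "q t"]
  have "?A *v q'' t + A' t *v q' t = 0"
    using constraint_derivative[OF interval_at_within_neq_bot[OF time t] t A_deriv[OF t] acceleration[OF t]]
      constraint by blast
  then have \<Omega>: "?\<Omega> *v q' t = projQ ?A *v q'' t"
    by (rule matOmega_eq_normal_acceleration[OF constraint[OF t]])
  \<comment> \<open>With the tangential part removed by S, the full acceleration may be replaced by
    its normal part, which is \<open>?\<Omega> *v q' t\<close>.\<close>
  have "?S *v (?M *v (projP ?A *v q'' t)) = 0"
    by (simp add: matrix_vector_mul_assoc matrix_mul_assoc matS_M_projP[OF M mu_pos])
  then have Sq: "?S *v (?M *v (?\<Omega> *v q' t)) = ?S *v (?M *v q'' t)"
    by (simp add: \<Omega> projQ_def matrix_vector_mult_diff_rdistrib matrix_vector_mult_diff_distrib)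
  have "fc t = ?M *v q'' t - (f t + ?h)"
    using dynamics[OF t] by (simp add: hvec_def algebra_simps)
  \<comment> \<open>Applying S leaves the constraint force unchanged, so the equation of motion can
    be solved for it.\<close>
  moreover have "fc t = ?S *v fc t"
    by (simp add: matS_fixes[OF M mu_pos] constraint_force[OF t])
  ultimately have "fc t = ?S *v (?M *v q'' t) - ?S *v (f t + ?h)"
    by (metis matrix_vector_mult_diff_distrib)
  then show "fc t = - (?S *v (f t + ?h - ?M *v (?\<Omega> *v q' t)))"
    by (simp only: matrix_vector_mult_diff_distrib[of ?S "f t + ?h"] Sq minus_diff_eq)
qed

end
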